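(* Let $(g,u)$ be an $n$-person game in normal form, where $g : X = X_1 \times \cdots \times X_n \to A$ is a game form and $u=(u_1,\ldots,u_n)$ is a preference profile. For every D-box $Y = Y_1\times\cdots\times Y_n \subseteq X$, every player $i \in I=\{1,\ldots,n\}$ and every strategy $x_i \in X_i$, there exists a strategy $y_i \in Y_i$ such that $y_i \succeq x_i \mod Y$.
   Context: Let $I=\{1,\ldots,n\}$ be the set of players; each player $i\in I$ has a finite non-empty set of strategies $X_i$, and $X = X_1\times\cdots\times X_n$ is the set of strategy profiles. A game form is a mapping $g : X \to A$, where $A=\{a_1,\ldots,a_p\}$ is a finite set of outcomes. A preference profile $u=(u_1,\ldots,u_n)$ assigns to each player $i$ a complete strict order $u_i$ over $A$; equivalently, each player $i$ has a function $u(i,\cdot): A \to \mathbb{R}$ such that $u(i,a)=u(i,a')$ implies $a=a'$ (only the order matters). Write $u(i,x)=u(i,g(x))$ for $x \in X$. The pair $(g,u)$ is a game in normal form. Box: $Y=Y_1\times\cdots\times Y_n$ is a box of $X$, written $Y\subseteq X$, if $\emptyset\ne Y_i\subseteq X_i$ for all $i\in I$. Domination modulo a box: for a box $Y\subseteq X$, a player $i$ and two strategies $x_i,x'_i\in X_i$ (not necessarily in $Y_i$), we write $x_i\succeq x'_i \mod Y$ (and say that $x_i$ dominates $x'_i$ modulo $Y$) if $u(i,x)\ge u(i,x')$ for every two profiles $x,x' \in X$ whose $i$-th coordinates are $x_i$ and $x'_i$ respectively and such that $x_j=x'_j\in Y_j$ for all $j\in I\setminus\{i\}$. D-box: starting from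 $X$, successively eliminate dominated strategies of (possibly different) players one by one, in some order. One step passes from a current box $Z$ to the box obtained by deleting from $Z_i$, for some $i\in I$, a strategy $x'_i\in Z_i$ such that $x_i\succeq x'_i \mod Z$ for some $x_i\in Z_i$, $x_i\neq x'_i$. Any box obtained from $X$ by finitely many (possibly zero) such steps is called a D-box of $X$. *)

theory Defs
  imports Complex_Main "HOL-Library.FuncSet"
begin

(* The strategies of all players live in one type 's; X i is the strategy set of player i.
   Values of X (and of boxes) outside {1..n} are irrelevant. *)

definition profiles :: "nat \<Rightarrow> (nat \<Rightarrow> 's set) \<Rightarrow> (nat \<Rightarrow> 's) set" where
  "profiles n X = Pi\<^sub>E {1..n} X"

definition game_form ::
  "nat \<Rightarrow> (nat \<Rightarrow> 's set) \<Rightarrow> 'a set \<Rightarrow> ((nat \<Rightarrow> 's) \<Rightarrow> 'a) \<Rightarrow> bool" where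
  "game_form n X A g \<longleftrightarrow>
     (\<forall>i\<in>{1..n}. finite (X i) \<and> X i \<noteq> {}) \<and> finite A \<and> g \<in> profiles n X \<rightarrow> A"

(* A strict linear order of player i on A is given by a utility function without ties on A. *)
definition preference_profile :: "nat \<Rightarrow> 'a set \<Rightarrow> (nat \<Rightarrow> 'a \<Rightarrow> real) \<Rightarrow> bool" where
  "preference_profile n A u \<longleftrightarrow> (\<forall>i\<in>{1..n}. inj_on (u i) A)"

definition normal_form_game ::
  "nat \<Rightarrow> (nat \<Rightarrow> 's set) \<Rightarrow> 'a set \<Rightarrow> ((nat \<Rightarrow> 's) \<Rightarrow> 'a) \<Rightarrow> (nat \<Rightarrow> 'a \<Rightarrow> real) \<Rightarrow> bool" where
  "normal_form_game n X A g u \<longleftrightarrow> game_form n X A g \<and> preference_profile n A u"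

definition is_box :: "nat \<Rightarrow> (nat \<Rightarrow> 's set) \<Rightarrow> (nat \<Rightarrow> 's set) \<Rightarrow> bool" where
  "is_box n X Y \<longleftrightarrow> (\<forall>i\<in>{1..n}. Y i \<noteq> {} \<and> Y i \<subseteq> X i)"

(* s and t are strategies in X i, not necessarily in Y i. *)
definition dominates_mod ::
  "nat \<Rightarrow> (nat \<Rightarrow> 's set) \<Rightarrow> ((nat \<Rightarrow> 's) \<Rightarrow> 'a) \<Rightarrow> (nat \<Rightarrow> 'a \<Rightarrow> real) \<Rightarrow>
   (nat \<Rightarrow> 's set) \<Rightarrow> nat \<Rightarrow> 's \<Rightarrow> 's \<Rightarrow> bool" where
  "dominates_mod n X g u Y i s t \<longleftrightarrow>
     (\<forall>x\<in>profiles n X. \<forall>x'\<in>profiles n X.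
        x i = s \<and> x' i = t \<and> (\<forall>j\<in>{1..n} - {i}. x j = x' j \<and> x j \<in> Y j) \<longrightarrow>
        u i (g x) \<ge> u i (g x'))"

inductive D_box ::
  "nat \<Rightarrow> (nat \<Rightarrow> 's set) \<Rightarrow> ((nat \<Rightarrow> 's) \<Rightarrow> 'a) \<Rightarrow> (nat \<Rightarrow> 'a \<Rightarrow> real) \<Rightarrow> (nat \<Rightarrow> 's set) \<Rightarrow> bool"
  for n X g u where
  start: "D_box n X g u X"
| eliminate: "D_box n X g u (Z(i := Z i - {t}))"
    if "D_box n X g u Z" "i \<in> {1..n}" "s \<in> Z i" "t \<in> Z i" "s \<noteq> t"
       "dominates_mod n X g u Z i s t"

(* Elimination steps lead from boxes to boxes, so D_box need not demand this. *)
lemma D_box_is_box: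
  assumes "D_box n X g u Y" "normal_form_game n X A g u"
  shows "is_box n X Y"
  using assms
  by (induction rule: D_box.induct)
    (auto simp: is_box_def normal_form_game_def game_form_def)

end

theory Submission
  imports Defs
begin

text \<open>
  The proof is by induction on the elimination sequence. Domination modulo a fixed box is a preorder
  on the strategies of a player, and it is inherited by smaller boxes because fewer combinations of
  the opponents' strategies have to be compared. A dominator found before an elimination step
  therefore still dominates afterwards; the only danger is that it is itself the deleted strategy.
  In that case the strategy that justified the deletion takes its place, by transitivity, and it
  survives the step because strategies are deleted one at a time.
\<close>

text \<open>Two profiles that agree on every player are the same function, because profiles take the
  default value outside \<open>{1..n}\<close>; hence \<open>g\<close> gives them the same outcome.\<close>

lemma dominates_mod_refl: "dominates_mod n X g u Y i s s"
  unfolding dominates_mod_def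
proof (intro ballI impI)
  fix x x'
  assume prof: "x \<in> profiles n X" "x' \<in> profiles n X"
    and agree: "x i = s \<and> x' i = s \<and> (\<forall>j\<in>{1..n} - {i}. x j = x' j \<and> x j \<in> Y j)"
  have "x = x'"
  proof (rule PiE_ext)
    show "x \<in> Pi\<^sub>E {1..n} X" "x' \<in> Pi\<^sub>E {1..n} X"
      using prof by (simp_all add: profiles_def)
    show "x j = x' j" if "j \<in> {1..n}" for j
      using agree that by (cases "j = i") auto
  qed
  then show "u i (g x) \<ge> u i (g x')" by simp
qed

text \<open>The two comparisons are chained through the profile in which player \<open>i\<close> switches to the middle
  strategy. That profile exists only if this strategy belongs to \<open>X i\<close>: otherwise both hypotheses
  on it would be vacuous.\<close>

lemma dominates_mod_trans:
  assumes "dominates_mod n X g u Y i r s" "dominates_mod n X g u Y i s t"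
    and "i \<in> {1..n}" "s \<in> X i"
  shows "dominates_mod n X g u Y i r t"
  unfolding dominates_mod_def
proof (intro ballI impI)
  fix x x'
  assume prof: "x \<in> profiles n X" "x' \<in> profiles n X"
    and agree: "x i = r \<and> x' i = t \<and> (\<forall>j\<in>{1..n} - {i}. x j = x' j \<and> x j \<in> Y j)"
  let ?z = "x(i := s)"
  have z: "?z \<in> profiles n X"
    using prof(1) assms(3,4) by (auto simp: profiles_def PiE_iff extensional_def)
  have ends: "x i = r" "x' i = t"
    and in_Y: "\<forall>j\<in>{1..n} - {i}. x j \<in> Y j"
    and same: "\<forall>j\<in>{1..n} - {i}. x j = x' j"
    using agree by blast+
  have "x i = r \<and> ?z i = s \<and> (\<forall>j\<in>{1..n} - {i}. x j = ?z j \<and> x j \<in> Y j)"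
    using ends(1) in_Y by simp
  then have "u i (g x) \<ge> u i (g ?z)"
    using assms(1) prof(1) z unfolding dominates_mod_def by blast
  moreover have "?z i = s \<and> (\<forall>j\<in>{1..n} - {i}. ?z j = x' j)"
    using same by simp
  moreover have "\<forall>j\<in>{1..n} - {i}. ?z j \<in> Y j"
    using in_Y by simp
  ultimately have "u i (g x) \<ge> u i (g ?z)" "u i (g ?z) \<ge> u i (g x')"
    using assms(2) prof(2) z ends(2) unfolding dominates_mod_def by blast+
  then show "u i (g x) \<ge> u i (g x')" by simp
qed

lemma dominates_mod_antimono:
  assumes "dominates_mod n X g u Z i s t" "\<And>j. j \<in> {1..n} - {i} \<Longrightarrow> Y j \<subseteq> Z j"
  shows "dominates_mod n X g u Y i s t"
  using assms unfolding dominates_mod_def by blast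

theorem lemma1:
  fixes n :: nat and X :: "nat \<Rightarrow> 's set" and A :: "'a set"
    and g :: "(nat \<Rightarrow> 's) \<Rightarrow> 'a" and u :: "nat \<Rightarrow> 'a \<Rightarrow> real"
  assumes "normal_form_game n X A g u"
  shows "\<forall>Y. D_box n X g u Y \<longrightarrow>
           (\<forall>i\<in>{1..n}. \<forall>x\<in>X i. \<exists>y\<in>Y i. dominates_mod n X g u Y i y x)"
proof (intro allI impI)
  fix Y assume "D_box n X g u Y"
  then show "\<forall>i\<in>{1..n}. \<forall>x\<in>X i. \<exists>y\<in>Y i. dominates_mod n X g u Y i y x"
  proof (induction rule: D_box.induct)
    case start
    show ?case
    proof (intro ballI)
      fix i x assume "x \<in> X i"
      with dominates_mod_refl[of n X g u X i x]
      show "\<exists>y\<in>X i. dominates_mod n X g u X i y x" by (rule bexI)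
    qed
  next
    case (eliminate Z k s t)
    let ?Z' = "Z(k := Z k - {t})"
    have shrink: "dominates_mod n X g u ?Z' i y x"
      if "dominates_mod n X g u Z i y x" for i y x
      using that by (rule dominates_mod_antimono) auto
    show ?case
    proof (intro ballI)
      fix i x assume i: "i \<in> {1..n}" and x: "x \<in> X i"
      obtain y where y: "y \<in> Z i" "dominates_mod n X g u Z i y x"
        using eliminate.IH i x by blast
      show "\<exists>y\<in>?Z' i. dominates_mod n X g u ?Z' i y x"
      proof (cases "i = k \<and> y = t")
        case True
        have "t \<in> X k"
          using D_box_is_box[OF eliminate.hyps(1) assms] eliminate.hyps(2,4)
          by (auto simp: is_box_def)
        then have "dominates_mod n X g u Z i s x"
          using dominates_mod_trans[OF eliminate.hyps(6)] y(2) i True by blast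
        moreover have "s \<in> ?Z' i"
          using eliminate.hyps(3,5) True by simp
        ultimately show ?thesis using shrink by blast
      next
        case False
        then have "y \<in> ?Z' i" using y(1) by auto
        then show ?thesis using shrink y(2) by blast
      qed
    qed
  qed
qed

end
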